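(* Let $s_1,s_2,u_1,u_2>0$ with $s_2/s_1$ irrational and $u_1\neq u_2$, and consider the bi-partition $\{R_1,R_2\}$, the lattice $L$, the fan of bases $(e_i,f_i)$ and the matrices $\begin{bmatrix} k_i & l_i\\ m_i & n_i\end{bmatrix}$ defined in the context. For a basis $(e_i,f_i)$, $i\geq 2$, let $p=k_i+m_i$, $r=l_i+n_i$, and suppose $p\geq 2$, $r\geq 2$. Let $\{c_j\}_{j\in\mathbb Z}$ be the principal tiling, indexed so that its lock is $[c_0,c_1]$. Then the three words $$(c_2,\dots,c_{p-1}),\quad (c_2,\dots,c_{r-1}),\quad (c_2,\dots,c_{p+r-1})$$ are palindromes. Moreover $$(c_2,\dots,c_{p+r-1})=(c_2,\dots,c_{p-1},\,b,a,\,c_2,\dots,c_{r-1})=(c_2,\dots,c_{r-1},\,a,b,\,c_2,\dots,c_{p-1}).$$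
   Context: Bi-partition: $R_1=[0,s_1]\times[0,u_1]$, $R_2=[-s_2,0]\times[0,u_2]$, $e_0=(s_2,u_1)$, $f_0=(-s_1,u_2)$, $L=\mathbb Ze_0+\mathbb Zf_0\subset\mathbb R^2$. The $L$-translates of $R_1$ and $R_2$ tile the plane. The horizontal spine is $J^s=[-s_2,s_1]\times\{0\}$ and the vertical spine is $J^u=\{0\}\times[0,u_1+u_2]$; the translates of $J^s$ (resp. $J^u$) by $L$ cover all horizontal (resp. vertical) sides of the tiles. Intersection tilings: let $\ell$ be a vertical line in $\mathbb R^2$. If $\ell$ contains no point of $L$, the rectangles of the plane tiling cut $\ell$ into consecutive segments (tiles); reading upwards and writing $a$ for a segment inside a translate of $R_1$ (length $u_1$) and $b$ for a segment inside a translate of $R_2$ (length $u_2$) gives a sequence in $\{a,b\}^{\mathbb Z}$. If $\ell$ contains a point $z\in L$ (unique in the irrational case), then $\ell$ contains $J^u+z$, and there are two tilings of $\ell$, which coincide outside $J^u+z$, while the part $J^u+z$ is read upwards as $[a,b]$ (using the rectangles on the right of $\ell$) or as $[b,a]$ (using the rectangles on the left of $\ell$). These two tilings are called principal tilings, and the ambiguous part $J^u+z$ is called the lock. The principal tiling is unique up to shift and the change of the lock; "the principal tiling" refers to either choice. Fan of bases: starting from $(e_0,f_0)$, for $i\ge 0$ put $(e_{i+1},f_{i+1})=(e_i+f_i,f_i)$ if $e_i+f_i$ lies in the first quadrant (positive first coordinate), and $(e_{i+1},f_{i+1})=(e_i,e_i+f_i)$ if $e_i+f_i$ lies in the second quadrant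 (negative first coordinate). Thus each $e_i$ lies in the first quadrant and each $f_i$ in the second. The non-negative integers $k_i,l_i,m_i,n_i$ are defined by $e_i=k_ie_0+m_if_0$, $f_i=l_ie_0+n_if_0$; the matrix $\begin{bmatrix} k_i & l_i\\ m_i & n_i\end{bmatrix}$ belongs to $SL(2,\mathbb Z)$. A word is a palindrome if it equals its reversal; a word $(c_2,\dots,c_{q-1})$ with $q=2$ is the empty word, which is a palindrome. *)

theory Defs
  imports "HOL-Analysis.Product_Vector"
begin

datatype letter = A | B

fun tile :: "real \<Rightarrow> real \<Rightarrow> real \<Rightarrow> real \<Rightarrow> letter \<Rightarrow> (real \<times> real) set" where
  "tile s1 s2 u1 u2 A = {0..s1} \<times> {0..u1}"
| "tile s1 s2 u1 u2 B = {-s2..0} \<times> {0..u2}"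

definition lattice :: "real \<Rightarrow> real \<Rightarrow> real \<Rightarrow> real \<Rightarrow> (real \<times> real) set" where
  "lattice s1 s2 u1 u2 =
     {real_of_int m *\<^sub>R (s2, u1) + real_of_int n *\<^sub>R (-s1, u2) | m n. True}"

definition vertical_spine :: "real \<Rightarrow> real \<Rightarrow> (real \<times> real) set" where
  "vertical_spine u1 u2 = {0} \<times> {0..u1 + u2}"

text \<open>
  The sequence \<open>c\<close> is read upwards along the vertical line with abscissa \<open>x\<close>, the \<open>j\<close>-th segment
  having ordinates \<open>t j\<close> to \<open>t (j + 1)\<close>. Only translated rectangles meeting \<open>H\<close> may be used;
  \<open>H\<close> will be one of the two open half planes bounded by the line. This matters only for
  rectangles having a side on the line: those crossing it in their interior meet both half planes.
  Every segment has length \<open>u1\<close> or \<open>u2\<close>, so the segments exhaust the line.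
\<close>

definition line_tiling ::
  "real \<Rightarrow> real \<Rightarrow> real \<Rightarrow> real \<Rightarrow> real \<Rightarrow> (real \<times> real) set \<Rightarrow>
     (int \<Rightarrow> letter) \<Rightarrow> (int \<Rightarrow> real) \<Rightarrow> bool" where
  "line_tiling s1 s2 u1 u2 x H c t \<longleftrightarrow>
     (\<forall>j. t j < t (j + 1) \<and>
        (\<exists>v \<in> lattice s1 s2 u1 u2.
           {x} \<times> {t j..t (j + 1)} = ({x} \<times> UNIV) \<inter> (+) v ` tile s1 s2 u1 u2 (c j) \<and>
           H \<inter> (+) v ` tile s1 s2 u1 u2 (c j) \<noteq> {}))"

text \<open>
  Either of the two tilings of a vertical line through a lattice point \<open>z\<close>, read from the
  rectangles on the right or on the left, and indexed so that the lock, i.e. the part in the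
  translate of the vertical spine by \<open>z\<close>, consists of the segments with indices 0 and 1.
\<close>

definition principal_tiling ::
  "real \<Rightarrow> real \<Rightarrow> real \<Rightarrow> real \<Rightarrow> (int \<Rightarrow> letter) \<Rightarrow> bool" where
  "principal_tiling s1 s2 u1 u2 c \<longleftrightarrow>
     (\<exists>z \<in> lattice s1 s2 u1 u2. \<exists>t.
        (line_tiling s1 s2 u1 u2 (fst z) ({fst z<..} \<times> UNIV) c t \<or>
         line_tiling s1 s2 u1 u2 (fst z) ({..<fst z} \<times> UNIV) c t) \<and>
        {fst z} \<times> {t 0..t 2} = (+) z ` vertical_spine u1 u2)"

text \<open>If \<open>s2 / s1\<close> is irrational, the first coordinate of \<open>e + f\<close> below never vanishes.\<close>

fun fan :: "real \<Rightarrow> real \<Rightarrow> real \<Rightarrow> real \<Rightarrow> nat \<Rightarrow> (real \<times> real) \<times> (real \<times> real)" where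
  "fan s1 s2 u1 u2 0 = ((s2, u1), (-s1, u2))"
| "fan s1 s2 u1 u2 (Suc i) =
     (let (e, f) = fan s1 s2 u1 u2 i
      in if fst (e + f) > 0 then (e + f, f) else (e, e + f))"

definition word :: "(int \<Rightarrow> letter) \<Rightarrow> int \<Rightarrow> int \<Rightarrow> letter list" where
  "word c m n = map c [m..n]"

definition palindrome :: "'a list \<Rightarrow> bool" where
  "palindrome w \<longleftrightarrow> rev w = w"

end

theory Submission
  imports Defs
begin

text \<open>
  Put the lattice point carrying the lock at the origin and read the vertical axis upwards. Each
  segment belongs to a rectangle attached to a lattice point, and passing to the next segment adds
  \<open>e\<^sub>0 = (s2, u1)\<close> after a letter \<open>A\<close> and \<open>f\<^sub>0 = (-s1, u2)\<close> after a letter \<open>B\<close>. The abscissae of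
  these lattice points are therefore an orbit of a rotation on an interval of length \<open>s1 + s2\<close>.
  After \<open>j \<ge> 2\<close> steps the lattice point is determined by \<open>j\<close> alone: it is the only one with
  coefficients of sum \<open>j\<close> and abscissa in \<open>(-s1, s2)\<close>. This turns every statement about the
  tiling into one about lattice points in a window (\<open>principal_tiling_codes\<close>,
  \<open>drift_window_unique\<close>).

  Say that a lattice point has index \<open>j\<close> if its coefficients have sum \<open>j\<close>. The vectors \<open>e = e\<^sub>i\<close>,
  \<open>f = f\<^sub>i\<close> and \<open>e + f\<close>, of indices \<open>p\<close>, \<open>r\<close> and \<open>p + r\<close>, lie on the orbit and are best
  approximations of the axis from their side: since \<open>e\<close> and \<open>f\<close> form a basis and lie on different
  sides of the axis, a lattice point of smaller positive index on the same side is further away.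
  For index below \<open>p\<close>, a lattice point to the right of the axis is even at least as far away as
  the distances of \<open>e\<close> and \<open>f\<close> together, and so is, for index below \<open>r\<close>, one to the left (\<open>gap_e\<close>,
  \<open>gap_f\<close>, \<open>gap_e_add_f\<close>).

  For a point \<open>w\<close> of the orbit, the map \<open>v \<mapsto> w + e\<^sub>0 + f\<^sub>0 - v\<close> can throw an orbit point of
  index between \<open>2\<close> and that of \<open>w\<close> out of the window only if some lattice point of smaller
  positive index lies on the same side of the axis as \<open>w\<close> and no further away. For \<open>w \<in> {e, f, e + f}\<close> there is none, so the map reverses the
  orbit segment, and the word is a palindrome (\<open>codes_palindrome\<close>). In the same way, translation
  by \<open>e\<close> carries the orbit points of indices \<open>2, \<dots>, r\<close> to orbit points, and translation by \<open>f\<close>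
  those of indices \<open>2, \<dots>, p\<close>; this yields the two factorisations (\<open>codes_concat\<close>). The letters
  between the factors are \<open>B, A\<close> after \<open>e\<close>, which lies to the right of the axis, and \<open>A, B\<close> after
  \<open>f\<close>, which lies to the left.
\<close>

section \<open>Lattice points seen from the vertical line\<close>

text \<open>
  Abscissa of the lattice point \<open>a e\<^sub>0 + (j - a) f\<^sub>0\<close> of index \<open>j\<close>. This parametrisation is
  adapted to reading the line upwards: \<open>j\<close> counts the segments below the point and \<open>a\<close> the letters
  \<open>A\<close> among them.
\<close>

definition drift :: "real \<Rightarrow> real \<Rightarrow> int \<Rightarrow> int \<Rightarrow> real" where
  "drift s1 s2 a j = of_int a * s2 - of_int (j - a) * s1"

lemma drift_add: "drift s1 s2 (a + b) (i + j) = drift s1 s2 a i + drift s1 s2 b j"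
  by (simp add: drift_def algebra_simps)

lemma drift_diff: "drift s1 s2 (a - b) (i - j) = drift s1 s2 a i - drift s1 s2 b j"
  by (simp add: drift_def algebra_simps)

lemma drift_mult: "drift s1 s2 (x * a) (x * j) = of_int x * drift s1 s2 a j"
  by (simp add: drift_def algebra_simps)

lemma drift_01 [simp]:
  "drift s1 s2 0 0 = 0" "drift s1 s2 1 1 = s2" "drift s1 s2 0 1 = - s1" "drift s1 s2 1 2 = s2 - s1"
  by (simp_all add: drift_def)

lemma drift_eq_0D:
  assumes "s1 > 0" "s2 / s1 \<notin> \<rat>" "drift s1 s2 a j = 0"
  shows "a = 0 \<and> j = 0"
proof -
  have eq: "of_int a * s2 = of_int (j - a) * s1"
    using assms(3) by (simp add: drift_def)
  have "a = 0"
  proof (rule ccontr)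
    assume "a \<noteq> 0"
    with eq \<open>s1 > 0\<close> have "s2 / s1 = of_int (j - a) / of_int a"
      by (simp add: field_simps)
    also have "\<dots> \<in> \<rat>" by (intro Rats_divide Rats_of_int)
    finally show False using assms(2) by blast
  qed
  with eq \<open>s1 > 0\<close> show ?thesis by simp
qed

text \<open>
  Two lattice points with the same index have abscissae that differ by a multiple of \<open>s1 + s2\<close>, so at
  most one of them has its abscissa in the window \<open>(-s1, s2)\<close>. This window is where a lattice point
  must lie for one of the two rectangles attached to it to cross the vertical axis.
\<close>

lemma drift_window_unique:
  assumes "- s1 < drift s1 s2 a j" "drift s1 s2 a j < s2"
    and "- s1 < drift s1 s2 b j" "drift s1 s2 b j < s2"
    and "s1 > 0" "s2 > 0"
  shows "a = b"
proof -
  have "drift s1 s2 a j - drift s1 s2 b j = of_int (a - b) * (s1 + s2)"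
    by (simp add: drift_def algebra_simps)
  moreover have "\<bar>drift s1 s2 a j - drift s1 s2 b j\<bar> < 1 * (s1 + s2)"
    using assms(1-4) by (simp add: abs_less_iff)
  ultimately have "\<bar>of_int (a - b) * (s1 + s2)\<bar> < 1 * (s1 + s2)" by simp
  then have "\<bar>of_int (a - b)\<bar> * (s1 + s2) < 1 * (s1 + s2)"
    using assms(5,6) by (simp add: abs_mult)
  then have "\<bar>of_int (a - b) :: real\<bar> < 1"
    using assms(5,6) by (simp only: mult_less_cancel_right_pos add_pos_pos)
  then have "\<bar>a - b\<bar> < 1" by linarith
  then show ?thesis by simp
qed

section \<open>The principal tiling as a rotation coding\<close>

text \<open>
  \<open>M j\<close> is the number of letters \<open>A\<close> among the first \<open>j\<close> segments above the lattice point that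
  carries the lock. Beyond the lock the two principal tilings agree, which is why the indices
  start at \<open>2\<close> and the window is open on both sides.
\<close>

definition codes :: "real \<Rightarrow> real \<Rightarrow> (int \<Rightarrow> letter) \<Rightarrow> (int \<Rightarrow> int) \<Rightarrow> bool" where
  "codes s1 s2 c M \<longleftrightarrow> (\<forall>j\<ge>2. - s1 < drift s1 s2 (M j) j \<and> drift s1 s2 (M j) j < s2 \<and>
     M (j + 1) = M j + (if c j = A then 1 else 0))"

lemma codes_eqI:
  assumes "codes s1 s2 c M" "s1 > 0" "s2 > 0" "j \<ge> 2"
    and "- s1 < drift s1 s2 a j" "drift s1 s2 a j < s2"
  shows "M j = a"
  using assms unfolding codes_def by (intro drift_window_unique[of s1 s2 "M j" j a]) auto

lemma codes_2:
  assumes "codes s1 s2 c M" "s1 > 0" "s2 > 0"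
  shows "M 2 = 1"
  using assms by (intro codes_eqI[OF assms]) auto

lemma codes_letter:
  assumes "codes s1 s2 c M" "j \<ge> 2"
  shows "c j = (if M (j + 1) = M j + 1 then A else B)"
  using assms by (cases "c j") (auto simp: codes_def)

fun side :: "real \<Rightarrow> real \<Rightarrow> real \<Rightarrow> real \<Rightarrow> letter \<Rightarrow> real \<times> real" where
  "side s1 s2 u1 u2 A = (s2, u1)"
| "side s1 s2 u1 u2 B = (-s1, u2)"

lemma translate_box:
  fixes a b c d :: real
  shows "(+) v ` ({a..b} \<times> {c..d}) = {fst v + a..fst v + b} \<times> {snd v + c..snd v + d}"
proof -
  have "(+) v ` ({a..b} \<times> {c..d}) = ((+) (fst v) ` {a..b}) \<times> ((+) (snd v) ` {c..d})"
    by (cases v) (force simp del: image_add_atLeastAtMost)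
  then show ?thesis by (simp add: add.commute)
qed

lemma line_Int_box:
  fixes x t :: real
  assumes "{x} \<times> {t..t'} = ({x} \<times> UNIV) \<inter> (+) v ` ({a..b} \<times> {0..h})" "t < t'"
  shows "a \<le> x - fst v \<and> x - fst v \<le> b \<and> t = snd v \<and> t' = snd v + h"
proof -
  have mem: "(y, z) \<in> {x} \<times> {t..t'} \<longleftrightarrow>
      y = x \<and> fst v + a \<le> y \<and> y \<le> fst v + b \<and> snd v \<le> z \<and> z \<le> snd v + h" for y z
    unfolding assms(1) translate_box by auto
  have xs: "fst v + a \<le> x" "x \<le> fst v + b" using mem[of x t] assms(2) by auto
  have "{t..t'} = {snd v..snd v + h}" using mem[of x] xs by (intro set_eqI) auto
  then have "t = snd v \<and> t' = snd v + h" using assms(2) unfolding Icc_eq_Icc by auto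
  then show ?thesis using xs by auto
qed

text \<open>
  The next segment starts at \<open>v + side (c j)\<close>: this lattice point has the right height, and it
  again lies in the window \<open>I\<close>. The window is closed at the end for which the rectangle with a side
  on the line lies in the chosen half plane.
\<close>

lemma line_tiling_vertices:
  assumes "line_tiling s1 s2 u1 u2 x H c t"
    and "(H, I) \<in> {({x<..} \<times> UNIV, {-s1<..s2}), ({..<x} \<times> UNIV, {-s1..<s2})}"
    and "s1 > 0" "s2 > 0"
  shows "\<exists>v\<in>lattice s1 s2 u1 u2. snd v = t j \<and> t (j + 1) = snd (v + side s1 s2 u1 u2 (c j)) \<and>
           fst v - x \<in> I \<and> fst (v + side s1 s2 u1 u2 (c j)) - x \<in> I"
proof -
  from assms(1) obtain v where v: "v \<in> lattice s1 s2 u1 u2" "t j < t (j + 1)"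
    "{x} \<times> {t j..t (j + 1)} = ({x} \<times> UNIV) \<inter> (+) v ` tile s1 s2 u1 u2 (c j)"
    "H \<inter> (+) v ` tile s1 s2 u1 u2 (c j) \<noteq> {}"
    unfolding line_tiling_def by blast
  have "snd v = t j \<and> t (j + 1) = snd (v + side s1 s2 u1 u2 (c j)) \<and>
           fst v - x \<in> I \<and> fst (v + side s1 s2 u1 u2 (c j)) - x \<in> I"
  proof (cases "c j")
    case A
    note box = line_Int_box[OF v(3)[unfolded A tile.simps] v(2)]
    show ?thesis using box v(4) assms(2-4) A by (auto simp: translate_box)
  next
    case B
    note box = line_Int_box[OF v(3)[unfolded B tile.simps] v(2)]
    show ?thesis using box v(4) assms(2-4) B by (auto simp: translate_box)
  qed
  with v(1) show ?thesis by blast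
qed

text \<open>
  A nonzero lattice vector of height \<open>0\<close> has coefficients of opposite signs, hence width at least
  \<open>s1 + s2\<close>. This holds even if \<open>u1 / u2\<close> is rational, when many lattice points share a height.
\<close>

lemma lattice_height_unique:
  assumes "v \<in> lattice s1 s2 u1 u2" "w \<in> lattice s1 s2 u1 u2"
    and "snd v = snd w" "\<bar>fst v - fst w\<bar> < s1 + s2"
    and pos: "s1 > 0" "s2 > 0" "u1 > 0" "u2 > 0"
  shows "v = w"
proof -
  from assms(1,2) obtain a b a' b' :: int where
    v: "v = of_int a *\<^sub>R (s2, u1) + of_int b *\<^sub>R (-s1, u2)" and
    w: "w = of_int a' *\<^sub>R (s2, u1) + of_int b' *\<^sub>R (-s1, u2)"
    unfolding lattice_def by blast
  define x y where "x = a - a'" and "y = b - b'"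
  have h: "of_int x * u1 + of_int y * u2 = 0"
    using assms(3) by (simp add: v w x_def y_def algebra_simps)
  have d: "\<bar>of_int x * s2 - of_int y * s1\<bar> < s1 + s2"
    using assms(4) by (simp add: v w x_def y_def algebra_simps)
  have False if "x \<ge> 1"
  proof -
    have "of_int x * u1 > 0" using that pos by simp
    then have "of_int y * u2 < 0" using h by linarith
    then have "y \<le> -1" using pos by (simp add: mult_less_0_iff)
    then have "1 * s1 \<le> of_int (- y) * s1" using pos by (intro mult_right_mono) linarith+
    moreover have "1 * s2 \<le> of_int x * s2" using that pos by (intro mult_right_mono) linarith+
    ultimately show False using d by simp
  qed
  moreover have False if "x \<le> -1"
  proof -
    have "of_int x * u1 < 0" using that pos by (simp add: mult_less_0_iff)
    then have "of_int y * u2 > 0" using h by linarith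
    then have "y \<ge> 1" using pos by (simp add: zero_less_mult_iff)
    then have "1 * s1 \<le> of_int y * s1" using pos by (intro mult_right_mono) linarith+
    moreover have "1 * s2 \<le> of_int (- x) * s2" using that pos by (intro mult_right_mono) linarith+
    ultimately show False using d by simp
  qed
  ultimately have "x = 0" by fastforce
  moreover from this h pos have "y = 0" by simp
  ultimately show ?thesis by (simp add: v w x_def y_def)
qed

lemma lattice_add_side:
  assumes "v \<in> lattice s1 s2 u1 u2"
  shows "v + side s1 s2 u1 u2 q \<in> lattice s1 s2 u1 u2"
proof -
  from assms obtain a b :: int where
    v: "v = of_int a *\<^sub>R (s2, u1) + of_int b *\<^sub>R (-s1, u2)"
    unfolding lattice_def by blast
  show ?thesis
  proof (cases q)
    case A
    have "v + side s1 s2 u1 u2 q = of_int (a + 1) *\<^sub>R (s2, u1) + of_int b *\<^sub>R (-s1, u2)"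
      by (simp add: v A algebra_simps)
    then show ?thesis unfolding lattice_def by blast
  next
    case B
    have "v + side s1 s2 u1 u2 q = of_int a *\<^sub>R (s2, u1) + of_int (b + 1) *\<^sub>R (-s1, u2)"
      by (simp add: v B algebra_simps)
    then show ?thesis unfolding lattice_def by blast
  qed
qed

text \<open>
  Consecutive segments are attached to lattice points \<open>v j\<close> and \<open>v (j + 1)\<close>; heights identify
  \<open>v (j + 1)\<close> with \<open>v j + side (c j)\<close>, and the position of the lock identifies \<open>v 0\<close> with \<open>z\<close>.
\<close>

lemma principal_tiling_codes:
  assumes pt: "principal_tiling s1 s2 u1 u2 c"
    and pos: "s1 > 0" "s2 > 0" "u1 > 0" "u2 > 0" and irr: "s2 / s1 \<notin> \<rat>"
  obtains M where "codes s1 s2 c M"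
proof -
  let ?L = "lattice s1 s2 u1 u2" and ?S = "side s1 s2 u1 u2"
  from pt obtain z t H I where z: "z \<in> ?L"
    and HI: "(H, I) \<in> {({fst z<..} \<times> UNIV, {-s1<..s2}), ({..<fst z} \<times> UNIV, {-s1..<s2})}"
    and lt: "line_tiling s1 s2 u1 u2 (fst z) H c t"
    and lock: "{fst z} \<times> {t 0..t 2} = (+) z ` vertical_spine u1 u2"
    unfolding principal_tiling_def by blast
  have "\<forall>j. \<exists>v\<in>?L. snd v = t j \<and> t (j + 1) = snd (v + ?S (c j)) \<and>
           fst v - fst z \<in> I \<and> fst (v + ?S (c j)) - fst z \<in> I"
    using line_tiling_vertices[OF lt HI pos(1,2)] by blast
  then obtain v where v: "v j \<in> ?L" "snd (v j) = t j" "t (j + 1) = snd (v j + ?S (c j))"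
    "fst (v j) - fst z \<in> I" "fst (v j + ?S (c j)) - fst z \<in> I" for j
    by metis
  have I_close: "\<bar>a - b\<bar> < s1 + s2" if "a - fst z \<in> I" "b - fst z \<in> I" for a b
    using that HI by auto
  have I_0: "0 \<in> I" using HI pos by auto
  have step: "v (j + 1) = v j + ?S (c j)" for j
    by (rule lattice_height_unique[OF v(1) lattice_add_side[OF v(1)] _ I_close pos])
       (use v[of j] v[of "j+1"] in auto)
  have "t 0 < t 1" "t 1 < t 2"
    using lt unfolding line_tiling_def by (metis add_0, metis one_add_one)
  moreover have "{fst z} \<times> {t 0..t 2} = ({fst z} \<times> UNIV) \<inter> (+) z ` ({0..0} \<times> {0..u1 + u2})"
    using translate_box[of z 0 0] by (auto simp: lock vertical_spine_def)
  ultimately have "t 0 = snd z"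
    using line_Int_box[of "fst z" "t 0" "t 2" z 0 0 "u1 + u2"] by auto
  then have v0: "v 0 = z"
    by (intro lattice_height_unique[OF v(1) z _ I_close pos]) (use v[of 0] I_0 in auto)
  define M where "M j = int (card ({0..<j} \<inter> c -` {A}))" for j
  have M_step: "M (j + 1) = M j + (if c j = A then 1 else 0)" if "j \<ge> 0" for j
  proof -
    have "{0..<j + 1} \<inter> c -` {A} =
        (if c j = A then insert j ({0..<j} \<inter> c -` {A}) else {0..<j} \<inter> c -` {A})"
      using that by (auto simp: less_le)
    then show ?thesis by (simp add: M_def)
  qed
  have abscissa: "fst (v j) - fst z = drift s1 s2 (M j) j" if "j \<ge> 0" for j
    using that
  proof (induction j rule: int_ge_induct)
    case base
    then show ?case by (simp add: v0 M_def)
  next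
    case (step j)
    then show ?case
      using \<open>v (j + 1) = v j + ?S (c j)\<close> M_step[of j]
        drift_add[of s1 s2 "M j" 1 j 1] drift_add[of s1 s2 "M j" 0 j 1]
      by (cases "c j") auto
  qed
  have "- s1 < drift s1 s2 (M j) j \<and> drift s1 s2 (M j) j < s2" if "j \<ge> 2" for j
  proof -
    \<comment> \<open>an end of the window would make \<open>v j\<close> equal to \<open>z + e\<^sub>0\<close> or \<open>z + f\<^sub>0\<close>, which have index \<open>1\<close>\<close>
    have "drift s1 s2 (M j) j \<noteq> s2"
      using drift_eq_0D[OF pos(1) irr, of "M j - 1" "j - 1"] that
      by (auto simp: drift_diff)
    moreover have "drift s1 s2 (M j) j \<noteq> - s1"
      using drift_eq_0D[OF pos(1) irr, of "M j - 0" "j - 1"] that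
      unfolding drift_diff by auto
    moreover have "drift s1 s2 (M j) j \<in> I" using v(4)[of j] abscissa[of j] that by simp
    ultimately show ?thesis using HI by auto
  qed
  then have "codes s1 s2 c M" using M_step by (simp add: codes_def)
  then show ?thesis by (rule that)
qed

section \<open>Bases of the lattice and return times\<close>

text \<open>
  The vectors \<open>e = k e\<^sub>0 + (p - k) f\<^sub>0\<close> and \<open>f = l e\<^sub>0 + (r - l) f\<^sub>0\<close> form a basis of the lattice:
  \<open>k r - l p\<close> is the determinant of their coefficients.
\<close>

locale fan_basis =
  fixes s1 s2 :: real and k l p r :: int
  assumes pos: "s1 > 0" "s2 > 0"
    and det: "k * r - l * p = 1"
    and e_pos: "drift s1 s2 k p > 0"
    and f_neg: "drift s1 s2 l r < 0"
    and p_ge: "p \<ge> 2" and r_ge: "r \<ge> 2"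
begin

abbreviation "\<delta> \<equiv> drift s1 s2"

lemma basis_coordinates:
  obtains x y where "j = x * p + y * r" "\<delta> a j = of_int x * \<delta> k p + of_int y * \<delta> l r"
proof
  define x y where "x = a * r - j * l" and "y = j * k - a * p"
  have "x * p + y * r = j * (k * r - l * p)" "x * k + y * l = a * (k * r - l * p)"
    by (simp_all add: x_def y_def algebra_simps)
  then have c: "x * p + y * r = j" "x * k + y * l = a" using det by simp_all
  show "j = x * p + y * r" using c by simp
  show "\<delta> a j = of_int x * \<delta> k p + of_int y * \<delta> l r"
    using drift_add[of s1 s2 "x * k" "y * l" "x * p" "y * r"] by (simp add: c drift_mult)
qed

lemma e_multiple_ge: "x \<ge> 1 \<Longrightarrow> of_int x * \<delta> k p \<ge> \<delta> k p"
  using mult_right_mono[of 1 "of_int x" "\<delta> k p"] e_pos by simp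

lemma e_multiple_le: "x \<le> 0 \<Longrightarrow> of_int x * \<delta> k p \<le> 0"
  using e_pos by (simp add: mult_le_0_iff)

lemma f_multiple_le: "y \<ge> 1 \<Longrightarrow> of_int y * \<delta> l r \<le> \<delta> l r"
  using mult_right_mono_neg[of 1 "of_int y" "\<delta> l r"] f_neg by simp

lemma f_multiple_ge: "y \<le> 0 \<Longrightarrow> of_int y * \<delta> l r \<ge> 0"
  using f_neg by (simp add: mult_nonpos_nonpos)

lemma index_mono: "x \<ge> 1 \<Longrightarrow> x * p \<ge> p" "y \<ge> 1 \<Longrightarrow> y * r \<ge> r"
  using mult_right_mono[of 1 x p] mult_right_mono[of 1 y r] p_ge r_ge by simp_all

lemma index_antimono: "x \<le> 0 \<Longrightarrow> x * p \<le> 0" "y \<le> 0 \<Longrightarrow> y * r \<le> 0"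
  using p_ge r_ge by (simp_all add: mult_nonpos_nonneg)

text \<open>
  The three gap lemmas express that \<open>e\<close>, \<open>f\<close> and \<open>e + f\<close> are best approximations of the axis from
  their side. In coordinates \<open>x e + y f\<close> a positive index forces one of \<open>x\<close>, \<open>y\<close> to be positive,
  and a small index then forces the other one not to be. Hence the abscissae of \<open>x e\<close> and \<open>y f\<close> cannot cancel.
\<close>

lemma gap_e:
  assumes "0 < j" "j < p"
  shows "\<delta> a j < 0 \<or> \<delta> a j \<ge> \<delta> k p - \<delta> l r"
proof -
  obtain x y where j: "j = x * p + y * r" and d: "\<delta> a j = of_int x * \<delta> k p + of_int y * \<delta> l r"
    by (rule basis_coordinates)
  show ?thesis
  proof (cases "x \<ge> 1")
    case True
    then have "y \<le> -1" using index_mono(1)[of x] index_antimono(2)[of "-y"] j assms by fastforce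
    then show ?thesis using e_multiple_ge[OF True] f_multiple_le[of "-y"] d by simp
  next
    case False
    then have "y \<ge> 1" using index_antimono(1)[of x] index_antimono(2)[of y] j assms by linarith
    then show ?thesis using e_multiple_le[of x] f_multiple_le[of y] d False f_neg by linarith
  qed
qed

lemma gap_f:
  assumes "0 < j" "j < r"
  shows "\<delta> a j > 0 \<or> \<delta> a j \<le> \<delta> l r - \<delta> k p"
proof -
  obtain x y where j: "j = x * p + y * r" and d: "\<delta> a j = of_int x * \<delta> k p + of_int y * \<delta> l r"
    by (rule basis_coordinates)
  show ?thesis
  proof (cases "y \<ge> 1")
    case True
    then have "x \<le> -1" using index_mono(2)[of y] index_antimono(1)[of "-x"] j assms by fastforce
    then show ?thesis using f_multiple_le[OF True] e_multiple_ge[of "-x"] d by simp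
  next
    case False
    then have "x \<ge> 1" using index_antimono(1)[of x] index_antimono(2)[of y] j assms by linarith
    then show ?thesis using f_multiple_ge[of y] e_multiple_ge[of x] d False e_pos by linarith
  qed
qed

lemma gap_e_add_f:
  assumes "0 < j" "j < p + r"
  shows "\<delta> a j \<ge> \<delta> k p \<or> \<delta> a j \<le> \<delta> l r"
proof -
  obtain x y where j: "j = x * p + y * r" and d: "\<delta> a j = of_int x * \<delta> k p + of_int y * \<delta> l r"
    by (rule basis_coordinates)
  show ?thesis
  proof (cases "x \<ge> 1")
    case True
    then have "y \<le> 0" using index_mono(1)[of x] index_mono(2)[of y] j assms by linarith
    then show ?thesis using e_multiple_ge[OF True] f_multiple_ge[of y] d by simp
  next
    case False
    then have "y \<ge> 1" using index_antimono(1)[of x] index_antimono(2)[of y] j assms by linarith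
    then show ?thesis using e_multiple_le[of x] f_multiple_le[of y] d False by linarith
  qed
qed

text \<open>
  The gaps at index \<open>1\<close>, where the lattice points \<open>e\<^sub>0\<close> and \<open>f\<^sub>0\<close> have abscissae \<open>s2\<close> and \<open>- s1\<close>.
  They place \<open>e\<close>, \<open>f\<close> and \<open>e + f\<close> inside the window, hence on the orbit.
\<close>

lemma width_le: "\<delta> k p - \<delta> l r \<le> s1" "\<delta> k p - \<delta> l r \<le> s2"
  using gap_e[of 1 1] gap_f[of 1 0] p_ge r_ge pos by auto

end

section \<open>Reversal and translation of the coding\<close>

lemma palindrome_wordI:
  assumes "\<And>j. 2 \<le> j \<Longrightarrow> j \<le> n - 1 \<Longrightarrow> c (n + 1 - j) = c j"
  shows "palindrome (word c 2 (n - 1))"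
  unfolding palindrome_def word_def
proof (rule nth_equalityI)
  fix i assume "i < length (rev (map c [2..n - 1]))"
  then have i: "int i < n - 2" by simp
  then have *: "nat (n - 2) - Suc i = nat (n - 3 - int i)" by (simp add: nat_diff_distrib)
  have "rev (map c [2..n - 1]) ! i = c (n + 1 - (2 + int i))"
    using i by (simp add: rev_nth nth_upto *)
  also have "\<dots> = c (2 + int i)" using i by (intro assms) auto
  also have "\<dots> = map c [2..n - 1] ! i" using i by (simp add: nth_upto)
  finally show "rev (map c [2..n - 1]) ! i = map c [2..n - 1] ! i" .
qed simp

lemma word_concat:
  assumes "m \<ge> 2" "n \<ge> 2" and "\<And>j. 2 \<le> j \<Longrightarrow> j \<le> n - 1 \<Longrightarrow> c (m + j) = c j"
  shows "word c 2 (m + n - 1) = word c 2 (m - 1) @ [c m, c (m + 1)] @ word c 2 (n - 1)"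
proof -
  have "[2..m + n - 1] = [2..m - 1] @ [m..m + n - 1]"
    using assms by (intro upto_split1) auto
  moreover have "[m..m + n - 1] = m # (m + 1) # [m + 2..m + n - 1]"
    using assms by (simp add: upto_rec1 add.commute)
  moreover have "map c [m + 2..m + n - 1] = map c [2..n - 1]"
    by (rule nth_equalityI) (use assms(3) in \<open>auto simp: nth_upto add.assoc\<close>)
  ultimately show ?thesis by (simp add: word_def)
qed

text \<open>
  The central symmetry that exchanges the ends of the chain of lattice points with indices
  \<open>2, \<dots>, n\<close> maps the chain to itself: by uniqueness in the window, the only obstruction is a point
  whose image leaves the window, and such a point minus \<open>f\<^sub>0\<close> or \<open>e\<^sub>0\<close> would have index smaller than
  \<open>n\<close> and be at least as close to the axis as the orbit point of index \<open>n\<close>, on the same side.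
\<close>

lemma codes_palindrome:
  assumes cod: "codes s1 s2 c M" and pos: "s1 > 0" "s2 > 0" and n: "n \<ge> 2"
    and gap: "\<And>a j. 0 < j \<Longrightarrow> j < n \<Longrightarrow>
      \<not> (0 < drift s1 s2 a j \<and> drift s1 s2 a j \<le> drift s1 s2 (M n) n) \<and>
      \<not> (drift s1 s2 (M n) n \<le> drift s1 s2 a j \<and> drift s1 s2 a j < 0)"
  shows "palindrome (word c 2 (n - 1))"
proof -
  have sym: "M (n + 2 - j) = M n + 1 - M j" if j: "2 \<le> j" "j \<le> n" for j
  proof (rule codes_eqI[OF cod pos])
    have w: "- s1 < drift s1 s2 (M j) j" "drift s1 s2 (M j) j < s2"
      using cod j by (auto simp: codes_def)
    have img: "drift s1 s2 (M n + 1 - M j) (n + 2 - j) =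
        drift s1 s2 (M n) n + (s2 - s1) - drift s1 s2 (M j) j"
      by (simp add: drift_diff drift_add)
    have f: "drift s1 s2 (M j) (j - 1) = drift s1 s2 (M j) j + s1"
      using drift_diff[of s1 s2 "M j" 0 j 1] by simp
    have e: "drift s1 s2 (M j - 1) (j - 1) = drift s1 s2 (M j) j - s2"
      by (simp add: drift_diff)
    note g = gap[of "j - 1" "M j"] gap[of "j - 1" "M j - 1"]
    show "- s1 < drift s1 s2 (M n + 1 - M j) (n + 2 - j)"
      using g w j unfolding img e f by linarith
    show "drift s1 s2 (M n + 1 - M j) (n + 2 - j) < s2"
      using g w j unfolding img e f by linarith
  qed (use j in simp)
  show ?thesis
  proof (rule palindrome_wordI)
    fix j assume j: "2 \<le> j" "j \<le> n - 1"
    have "M (n + 1 - j + 1) = M n + 1 - M j" using sym[of j] j by (simp add: algebra_simps)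
    moreover have "M (n + 1 - j) = M n + 1 - M (j + 1)"
      using sym[of "j + 1"] j by (simp add: algebra_simps)
    ultimately show "c (n + 1 - j) = c j"
      using j codes_letter[OF cod, of j] codes_letter[OF cod, of "n + 1 - j"] by auto
  qed
qed

text \<open>
  The same argument as for the central symmetry, with the translation by the orbit point of index
  \<open>m\<close>. An exceptional point now leads to a lattice point of index smaller than \<open>n\<close> that is at least
  as close to the axis as the orbit point of index \<open>m\<close>, on the opposite side.
\<close>

lemma codes_translate:
  assumes cod: "codes s1 s2 c M" and pos: "s1 > 0" "s2 > 0" and m: "m \<ge> 2"
    and gap: "\<And>a j. 0 < j \<Longrightarrow> j < n \<Longrightarrow>
      \<not> (0 < drift s1 s2 a j \<and> drift s1 s2 a j \<le> - drift s1 s2 (M m) m) \<and>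
      \<not> (- drift s1 s2 (M m) m \<le> drift s1 s2 a j \<and> drift s1 s2 a j < 0)"
    and j: "2 \<le> j" "j \<le> n"
  shows "M (m + j) = M m + M j"
proof (rule codes_eqI[OF cod pos])
  have w: "- s1 < drift s1 s2 (M j) j" "drift s1 s2 (M j) j < s2"
    using cod j by (auto simp: codes_def)
  have f: "drift s1 s2 (M j) (j - 1) = drift s1 s2 (M j) j + s1"
    using drift_diff[of s1 s2 "M j" 0 j 1] by simp
  have e: "drift s1 s2 (M j - 1) (j - 1) = drift s1 s2 (M j) j - s2"
    by (simp add: drift_diff)
  note g = gap[of "j - 1" "M j"] gap[of "j - 1" "M j - 1"]
  show "- s1 < drift s1 s2 (M m + M j) (m + j)"
    using g w j unfolding drift_add e f by linarith
  show "drift s1 s2 (M m + M j) (m + j) < s2"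
    using g w j unfolding drift_add e f by linarith
qed (use m j in simp)

text \<open>
  The translation carries the lock to the segments \<open>m\<close> and \<open>m + 1\<close>, which therefore show each
  letter once; only their order is left open, and \<open>M (m + 1)\<close> decides it.
\<close>

lemma codes_concat:
  assumes cod: "codes s1 s2 c M" and pos: "s1 > 0" "s2 > 0" and mn: "m \<ge> 2" "n \<ge> 2"
    and gap: "\<And>a j. 0 < j \<Longrightarrow> j < n \<Longrightarrow>
      \<not> (0 < drift s1 s2 a j \<and> drift s1 s2 a j \<le> - drift s1 s2 (M m) m) \<and>
      \<not> (- drift s1 s2 (M m) m \<le> drift s1 s2 a j \<and> drift s1 s2 a j < 0)"
  shows "word c 2 (m + n - 1) = word c 2 (m - 1) @
    (if M (m + 1) = M m then [B, A] else [A, B]) @ word c 2 (n - 1)"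
proof -
  note tr = codes_translate[OF cod pos mn(1) gap]
  have "c (m + j) = c j" if "2 \<le> j" "j \<le> n - 1" for j
    using codes_letter[OF cod, of j] codes_letter[OF cod, of "m + j"] tr[of j] tr[of "j + 1"]
      that mn by (auto simp: add.assoc)
  then have "word c 2 (m + n - 1) = word c 2 (m - 1) @ [c m, c (m + 1)] @ word c 2 (n - 1)"
    by (intro word_concat mn)
  moreover have "[c m, c (m + 1)] = (if M (m + 1) = M m then [B, A] else [A, B])"
  proof -
    have "M (m + 2) = M m + 1" using tr[of 2] codes_2[OF cod pos] mn by simp
    moreover have "M (m + 1) = M m + (if c m = A then 1 else 0)"
      "M (m + 2) = M (m + 1) + (if c (m + 1) = A then 1 else 0)"
      using cod[unfolded codes_def, rule_format, of m] mn
        cod[unfolded codes_def, rule_format, of "m + 1"] by (simp_all add: add.assoc)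
    ultimately show ?thesis by (cases "c m"; cases "c (m + 1)") auto
  qed
  ultimately show ?thesis by simp
qed

context fan_basis
begin

theorem words_of_basis:
  assumes cod: "codes s1 s2 c M"
  shows "palindrome (word c 2 (p - 1)) \<and> palindrome (word c 2 (r - 1)) \<and>
         palindrome (word c 2 (p + r - 1)) \<and>
         word c 2 (p + r - 1) = word c 2 (p - 1) @ [B, A] @ word c 2 (r - 1) \<and>
         word c 2 (p + r - 1) = word c 2 (r - 1) @ [A, B] @ word c 2 (p - 1)"
proof -
  note eqI = codes_eqI[OF cod pos]
  note ineqs = width_le e_pos f_neg pos p_ge r_ge
  have Mp: "M p = k" using ineqs by (intro eqI) linarith+
  have Mr: "M r = l" using ineqs by (intro eqI) linarith+
  have Mpr: "M (p + r) = k + l"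
    using ineqs by (intro eqI) (simp_all add: drift_add)
  have "M (p + 1) = k"
    using ineqs drift_add[of s1 s2 k 0 p 1] by (intro eqI) auto
  moreover have "M (r + 1) = l + 1"
    using ineqs drift_add[of s1 s2 l 1 r 1] by (intro eqI) auto
  moreover have "palindrome (word c 2 (p - 1))"
    by (rule codes_palindrome[OF cod pos p_ge])
       (use gap_e e_pos f_neg in \<open>simp add: Mp; smt (verit)\<close>)
  moreover have "palindrome (word c 2 (r - 1))"
    by (rule codes_palindrome[OF cod pos r_ge])
       (use gap_f e_pos f_neg in \<open>simp add: Mr; smt (verit)\<close>)
  moreover have "palindrome (word c 2 (p + r - 1))"
    by (rule codes_palindrome[OF cod pos])
       (use p_ge r_ge in simp, use gap_e_add_f e_pos f_neg in \<open>simp add: Mpr drift_add; smt (verit)\<close>)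
  moreover have "word c 2 (p + r - 1) = word c 2 (p - 1) @
      (if M (p + 1) = M p then [B, A] else [A, B]) @ word c 2 (r - 1)"
    by (rule codes_concat[OF cod pos p_ge r_ge])
       (use gap_f e_pos f_neg in \<open>simp add: Mp; smt (verit)\<close>)
  moreover have "word c 2 (r + p - 1) = word c 2 (r - 1) @
      (if M (r + 1) = M r then [B, A] else [A, B]) @ word c 2 (p - 1)"
    by (rule codes_concat[OF cod pos r_ge p_ge])
       (use gap_e e_pos f_neg in \<open>simp add: Mr; smt (verit)\<close>)
  ultimately show ?thesis by (simp add: Mp Mr add.commute)
qed

end

section \<open>The fan of bases\<close>

lemma lattice_coordinates_unique:
  fixes s1 s2 u1 u2 :: real
  assumes "a *\<^sub>R (s2, u1) + b *\<^sub>R (-s1, u2) = a' *\<^sub>R (s2, u1) + b' *\<^sub>R (-s1, u2)"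
    and pos: "s1 > 0" "s2 > 0" "u1 > 0" "u2 > 0"
  shows "a = a' \<and> b = b'"
proof -
  have 1: "(a - a') * s2 = (b - b') * s1" and 2: "(a - a') * u1 = - (b - b') * u2"
    using assms(1) by (auto simp: algebra_simps)
  have "(a - a') * (s2 * u2 + s1 * u1) = ((a - a') * s2) * u2 + ((a - a') * u1) * s1"
    by (simp add: algebra_simps)
  also have "\<dots> = 0" unfolding 1 2 by (simp add: algebra_simps)
  finally have "a = a'"
    using pos by (simp add: add_pos_pos less_imp_neq[symmetric])
  with 1 pos show ?thesis by simp
qed

text \<open>
  Irrationality keeps \<open>e + f\<close> off the vertical axis, so that each step of the fan preserves the
  signs of the two abscissae; adding one basis vector to the other preserves the determinant.
\<close>

lemma fan_unimodular:
  assumes "s1 > 0" "s2 > 0" "s2 / s1 \<notin> \<rat>"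
  shows "\<exists>k m l n :: int.
    fst (fan s1 s2 u1 u2 i) = of_int k *\<^sub>R (s2, u1) + of_int m *\<^sub>R (-s1, u2) \<and>
    snd (fan s1 s2 u1 u2 i) = of_int l *\<^sub>R (s2, u1) + of_int n *\<^sub>R (-s1, u2) \<and>
    k * n - l * m = 1 \<and> drift s1 s2 k (k + m) > 0 \<and> drift s1 s2 l (l + n) < 0"
proof (induction i)
  case 0
  show ?case
    by (intro exI[of _ 1] exI[of _ 0] exI[of _ 0] exI[of _ 1]) (use assms in simp)
next
  case (Suc i)
  then obtain k m l n :: int where
    e: "fst (fan s1 s2 u1 u2 i) = of_int k *\<^sub>R (s2, u1) + of_int m *\<^sub>R (-s1, u2)" and
    f: "snd (fan s1 s2 u1 u2 i) = of_int l *\<^sub>R (s2, u1) + of_int n *\<^sub>R (-s1, u2)" and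
    inv: "k * n - l * m = 1" "drift s1 s2 k (k + m) > 0" "drift s1 s2 l (l + n) < 0"
    by blast
  let ?g = "of_int (k + l) *\<^sub>R (s2, u1) + of_int (m + n) *\<^sub>R (-s1, u2)"
  have g: "fst (fan s1 s2 u1 u2 i) + snd (fan s1 s2 u1 u2 i) = ?g"
    unfolding e f by (simp add: algebra_simps)
  have fst_g: "fst ?g = drift s1 s2 (k + l) (k + l + (m + n))"
    by (simp add: drift_def)
  have nz: "drift s1 s2 (k + l) (k + l + (m + n)) \<noteq> 0"
  proof
    assume "drift s1 s2 (k + l) (k + l + (m + n)) = 0"
    then have "l = - k" "n = - m" using drift_eq_0D[OF assms(1,3)] by fastforce+
    with inv(1) show False by simp
  qed
  show ?case
  proof (cases "fst ?g > 0")
    case True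
    then have "fan s1 s2 u1 u2 (Suc i) = (?g, snd (fan s1 s2 u1 u2 i))"
      by (simp add: Let_def case_prod_beta g del: fst_add)
    moreover have "(k + l) * n - l * (m + n) = 1" using inv(1) by (simp add: algebra_simps)
    ultimately show ?thesis using True inv(3) f fst_g
      by (intro exI[of _ "k + l"] exI[of _ "m + n"] exI[of _ l] exI[of _ n]) simp
  next
    case False
    then have "fan s1 s2 u1 u2 (Suc i) = (fst (fan s1 s2 u1 u2 i), ?g)"
      by (simp add: Let_def case_prod_beta g del: fst_add)
    moreover have "k * (m + n) - (k + l) * m = 1" using inv(1) by (simp add: algebra_simps)
    ultimately show ?thesis using False nz inv(2) e fst_g
      by (intro exI[of _ k] exI[of _ m] exI[of _ "k + l"] exI[of _ "m + n"]) simp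
  qed
qed

theorem theorem3:
  fixes s1 s2 u1 u2 :: real and c :: "int \<Rightarrow> letter"
    and i k l m n p r :: nat
  assumes "s1 > 0" "s2 > 0" "u1 > 0" "u2 > 0"
    and "s2 / s1 \<notin> \<rat>" and "u1 \<noteq> u2"
    and "i \<ge> 2"
    and "fst (fan s1 s2 u1 u2 i) = real k *\<^sub>R (s2, u1) + real m *\<^sub>R (-s1, u2)"
    and "snd (fan s1 s2 u1 u2 i) = real l *\<^sub>R (s2, u1) + real n *\<^sub>R (-s1, u2)"
    and "p = k + m" and "r = l + n"
    and "p \<ge> 2" and "r \<ge> 2"
    and "principal_tiling s1 s2 u1 u2 c"
  shows "palindrome (word c 2 (int p - 1)) \<and>
         palindrome (word c 2 (int r - 1)) \<and>
         palindrome (word c 2 (int p + int r - 1)) \<and>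
         word c 2 (int p + int r - 1) = word c 2 (int p - 1) @ [B, A] @ word c 2 (int r - 1) \<and>
         word c 2 (int p + int r - 1) = word c 2 (int r - 1) @ [A, B] @ word c 2 (int p - 1)"
proof -
  note signs = assms(1-4)
  obtain k' m' l' n' :: int where
    e: "fst (fan s1 s2 u1 u2 i) = of_int k' *\<^sub>R (s2, u1) + of_int m' *\<^sub>R (-s1, u2)" and
    f: "snd (fan s1 s2 u1 u2 i) = of_int l' *\<^sub>R (s2, u1) + of_int n' *\<^sub>R (-s1, u2)" and
    inv: "k' * n' - l' * m' = 1" "drift s1 s2 k' (k' + m') > 0" "drift s1 s2 l' (l' + n') < 0"
    using fan_unimodular[OF assms(1,2,5)] by blast
  have "real k = of_int k' \<and> real m = of_int m'" "real l = of_int l' \<and> real n = of_int n'"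
    using lattice_coordinates_unique[OF _ signs] e f assms(8,9) by metis+
  then have eqs: "k' = int k" "m' = int m" "l' = int l" "n' = int n"
    by linarith+
  interpret fan_basis s1 s2 "int k" "int l" "int p" "int r"
    by unfold_locales (use assms(1,2,10-13) inv[unfolded eqs] in \<open>simp_all add: algebra_simps\<close>)
  obtain M where "codes s1 s2 c M"
    using principal_tiling_codes[OF assms(14) signs assms(5)] .
  then show ?thesis by (rule words_of_basis)
qed

end
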